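(* Let $p$ be an odd prime and let $G$ be a quasi-powerful $p$-group. Then $G^{p}=\{g^{p}\mid g\in G\}$.
   Context: For an odd prime $p$, a finite $p$-group $G$ is powerful if $[G,G]\le G^{p}$, where $G^{p}=\langle g^{p}\mid g\in G\rangle$, and $G$ is quasi-powerful if $G/Z(G)$ is powerful. *)

theory Defs
  imports "HOL-Algebra.Algebra"
begin

definition center :: "('a, 'b) monoid_scheme \<Rightarrow> 'a set" where
  "center G = {z \<in> carrier G. \<forall>g \<in> carrier G. z \<otimes>\<^bsub>G\<^esub> g = g \<otimes>\<^bsub>G\<^esub> z}"

definition p_group :: "nat \<Rightarrow> ('a, 'b) monoid_scheme \<Rightarrow> bool" where
  "p_group p G \<longleftrightarrow> group G \<and> finite (carrier G) \<and> (\<exists>n. order G = p ^ n)"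

definition pth_power_subgroup :: "nat \<Rightarrow> ('a, 'b) monoid_scheme \<Rightarrow> 'a set" where
  "pth_power_subgroup p G = generate G {g [^]\<^bsub>G\<^esub> p | g. g \<in> carrier G}"

definition powerful :: "nat \<Rightarrow> ('a, 'b) monoid_scheme \<Rightarrow> bool" where
  "powerful p G \<longleftrightarrow> derived G (carrier G) \<subseteq> pth_power_subgroup p G"

definition quasi_powerful :: "nat \<Rightarrow> ('a, 'b) monoid_scheme \<Rightarrow> bool" where
  "quasi_powerful p G \<longleftrightarrow> powerful p (G Mod center G)"

end

theory Submission
  imports Defs
begin

text \<open>Let \<open>K\<close> be the subgroup generated by the \<open>p\<close>-th powers of elements of \<open>G'\<close>. Commutator calculus
  in class at most 3, applied to suitable quotients, gives \<open>[G', G] \<le> K\<close>. Hence \<open>G/K\<close> has class at most 2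
  and its derived subgroup has exponent \<open>p\<close>, so that \<open>x \<mapsto> x\<^sup>p\<close> is an endomorphism of \<open>G/K\<close> and every
  \<open>g \<in> G\<^sup>p\<close> can be written as \<open>g = k x\<^sup>p\<close> with \<open>k \<in> K\<close>. The subgroup \<open>H = \<langle>x, G'\<rangle>\<close> satisfies
  \<open>H' \<le> K \<le> H\<^sup>p\<close> and \<open>g \<in> H\<^sup>p\<close>. If \<open>H\<close> is proper, then induction on the order applies to it;
  if \<open>H = G\<close>, then \<open>G\<close> is cyclic modulo \<open>G'\<close>, hence abelian by nilpotency, and \<open>K = 1\<close>.\<close>

section \<open>The center, and powers of a product whose commutator is central\<close>

lemma centerI:
  "\<lbrakk>z \<in> carrier G; \<And>g. g \<in> carrier G \<Longrightarrow> z \<otimes>\<^bsub>G\<^esub> g = g \<otimes>\<^bsub>G\<^esub> z\<rbrakk> \<Longrightarrow> z \<in> center G"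
  by (simp add: center_def)

lemma center_commute:
  "\<lbrakk>z \<in> center G; g \<in> carrier G\<rbrakk> \<Longrightarrow> z \<otimes>\<^bsub>G\<^esub> g = g \<otimes>\<^bsub>G\<^esub> z"
  by (simp add: center_def)

lemma center_subset: "center G \<subseteq> carrier G"
  by (auto simp: center_def)

context group
begin

text \<open>This is the centralizer of \<open>x\<close>. Intersecting over all \<open>x\<close>
  yields the center; applied in a quotient, it yields the preimages of centralizers used in
  \<open>derived_generate_insert_subset\<close>.\<close>

lemma subgroup_commuting:
  assumes x: "x \<in> carrier G"
  shows "subgroup {g \<in> carrier G. x \<otimes> g = g \<otimes> x} G"
proof (rule subgroupI)
  show "{g \<in> carrier G. x \<otimes> g = g \<otimes> x} \<noteq> {}"
    using x by (auto intro: exI[of _ \<one>])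
next
  fix a assume "a \<in> {g \<in> carrier G. x \<otimes> g = g \<otimes> x}"
  then have a: "a \<in> carrier G" "x \<otimes> a = a \<otimes> x" by auto
  have "inv a \<otimes> x = inv a \<otimes> (x \<otimes> a) \<otimes> inv a" using a(1) x by (simp add: m_assoc)
  also have "\<dots> = x \<otimes> inv a" unfolding a(2) using a(1) x by (simp flip: m_assoc)
  finally show "inv a \<in> {g \<in> carrier G. x \<otimes> g = g \<otimes> x}" using a by simp
next
  fix a b assume "a \<in> {g \<in> carrier G. x \<otimes> g = g \<otimes> x}" "b \<in> {g \<in> carrier G. x \<otimes> g = g \<otimes> x}"
  then have ab: "a \<in> carrier G" "x \<otimes> a = a \<otimes> x" "b \<in> carrier G" "x \<otimes> b = b \<otimes> x" by auto
  then have "x \<otimes> (a \<otimes> b) = a \<otimes> (x \<otimes> b)" using x by (metis m_assoc)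
  also have "\<dots> = a \<otimes> b \<otimes> x" using ab x by (simp add: m_assoc)
  finally show "a \<otimes> b \<in> {g \<in> carrier G. x \<otimes> g = g \<otimes> x}" using ab by simp
qed auto

lemma subgroup_center: "subgroup (center G) G"
proof -
  have "center G = (\<Inter>x\<in>carrier G. {g \<in> carrier G. x \<otimes> g = g \<otimes> x})"
    by (force simp: center_def)
  also have "subgroup \<dots> G"
    using subgroups_Inter[of "(\<lambda>x. {g \<in> carrier G. x \<otimes> g = g \<otimes> x}) ` carrier G"] subgroup_commuting
    by auto
  finally show ?thesis .
qed

lemma normal_center: "center G \<lhd> G"
proof (rule normal_invI[OF subgroup_center])
  fix x h assume "x \<in> carrier G" and h: "h \<in> center G"
  moreover have "h \<in> carrier G" using h center_subset[of G] by auto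
  ultimately have "x \<otimes> h \<otimes> inv x = h"
    using center_commute[OF h, of x] by (metis inv_solve_right' m_closed)
  then show "x \<otimes> h \<otimes> inv x \<in> center G" using h by simp
qed

text \<open>Here \<open>d\<close> is the commutator of \<open>c\<close> and \<open>x\<close>, and
  only the subgroup generated by \<open>x\<close> and \<open>c\<close> needs class at most 2.
  Collecting the factors \<open>x\<close> to the left leaves 0 + 1 + ... + (n - 1) copies of
  \<open>d\<close>, which is the binomial exponent. Stating commutation only for these elements lets
  the formula serve in class 3 as well, where \<open>c\<close> is itself a commutator.\<close>

lemma nat_pow_mult_commutator_central:
  assumes [simp]: "x \<in> carrier G" "c \<in> carrier G" "d \<in> carrier G"
    and cx: "c \<otimes> x = x \<otimes> c \<otimes> d"
    and dx: "d \<otimes> x = x \<otimes> d" and dc: "d \<otimes> c = c \<otimes> d"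
  shows "(x \<otimes> c) [^] n = x [^] n \<otimes> c [^] n \<otimes> d [^] (n choose 2)"
proof (induction n)
  case 0
  show ?case by (simp add: numeral_2_eq_2)
next
  case (Suc n)
  have dpow: "d [^] k \<otimes> y = y \<otimes> d [^] k" if "y \<in> carrier G" "d \<otimes> y = y \<otimes> d" for k :: nat and y
    using that by (induction k) (simp_all add: m_assoc, simp flip: m_assoc)
  note dc_pow = dpow[OF assms(2) dc]
  \<comment> \<open>Each factor \<open>c\<close> that \<open>x\<close> passes leaves one
    \<open>d\<close> behind.\<close>
  have cpow: "c [^] k \<otimes> x = x \<otimes> c [^] k \<otimes> d [^] k" for k :: nat
  proof (induction k)
    case (Suc k)
    have "c [^] Suc k \<otimes> x = c [^] k \<otimes> x \<otimes> c \<otimes> d"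
      by (simp add: m_assoc cx)
    also have "\<dots> = x \<otimes> c [^] k \<otimes> (d [^] k \<otimes> c) \<otimes> d"
      by (simp add: Suc m_assoc)
    also have "\<dots> = x \<otimes> c [^] Suc k \<otimes> d [^] Suc k"
      by (simp add: dc_pow m_assoc)
    finally show ?case .
  qed simp
  have "(x \<otimes> c) [^] Suc n = x [^] n \<otimes> c [^] n \<otimes> (d [^] (n choose 2) \<otimes> (x \<otimes> c))"
    by (simp add: Suc m_assoc)
  also have "d [^] (n choose 2) \<otimes> (x \<otimes> c) = x \<otimes> c \<otimes> d [^] (n choose 2)"
  proof (rule dpow)
    have "d \<otimes> (x \<otimes> c) = d \<otimes> x \<otimes> c" by (simp add: m_assoc)
    also have "\<dots> = x \<otimes> (d \<otimes> c)" by (simp add: dx m_assoc)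
    also have "\<dots> = x \<otimes> c \<otimes> d" by (simp add: dc m_assoc)
    finally show "d \<otimes> (x \<otimes> c) = x \<otimes> c \<otimes> d" .
  qed simp
  also have "x [^] n \<otimes> c [^] n \<otimes> (x \<otimes> c \<otimes> d [^] (n choose 2))
      = x [^] n \<otimes> (c [^] n \<otimes> x) \<otimes> c \<otimes> d [^] (n choose 2)"
    by (simp add: m_assoc)
  also have "\<dots> = x [^] Suc n \<otimes> c [^] n \<otimes> (d [^] n \<otimes> c) \<otimes> d [^] (n choose 2)"
    by (simp add: cpow m_assoc)
  also have "\<dots> = x [^] Suc n \<otimes> c [^] Suc n \<otimes> (d [^] n \<otimes> d [^] (n choose 2))"
    by (simp add: dc_pow m_assoc)
  \<comment> \<open>Pascal's rule for the column 2.\<close>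
  also have "d [^] n \<otimes> d [^] (n choose 2) = d [^] (Suc n choose 2)"
    by (simp add: nat_pow_mult numeral_2_eq_2)
  finally show ?case .
qed

end

text \<open>This is where oddness enters: if \<open>d\<close> has order dividing \<open>p\<close>,
  the correction term of the power formula vanishes at exponent \<open>p\<close>.\<close>

lemma dvd_choose_2:
  assumes "odd (p::nat)"
  shows "p dvd p choose 2"
proof -
  have "p choose 2 = p * ((p - 1) div 2)"
    using assms by (auto simp: choose_two elim: oddE)
  then show ?thesis by simp
qed

section \<open>The class equation of a finite p-group\<close>

text \<open>The fixed points of conjugation are the central elements. If only the identity were
  central, all other orbits would have size divisible by \<open>p\<close>, and so
  \<open>order G\<close> would be 1 modulo \<open>p\<close>.\<close>

lemma p_group_center_nontrivial:
  assumes p: "Factorial_Ring.prime p" and G: "p_group p G" and nt: "order G \<noteq> 1"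
  shows "\<exists>z \<in> center G. z \<noteq> \<one>\<^bsub>G\<^esub>"
proof (rule ccontr)
  interpret group G using G by (simp add: p_group_def)
  have fin: "finite (carrier G)" using G by (simp add: p_group_def)
  obtain n where n: "order G = p ^ n" using G by (auto simp: p_group_def)
  let ?f = "\<lambda>g. \<lambda>h\<in>carrier G. g \<otimes>\<^bsub>G\<^esub> h \<otimes>\<^bsub>G\<^esub> inv\<^bsub>G\<^esub> g"
  interpret A: group_action G "carrier G" ?f by (rule action_by_conjugation)
  let ?O = "orbits G (carrier G) ?f"
  assume "\<not> ?thesis"
  then have triv: "z = \<one>\<^bsub>G\<^esub>" if "z \<in> center G" for z using that by blast
  have O1: "{\<one>\<^bsub>G\<^esub>} \<in> ?O"
    unfolding orbits_def orbit_def by (force intro!: exI[of _ "\<one>\<^bsub>G\<^esub>"])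
  have "p dvd card u" if u: "u \<in> ?O - {{\<one>\<^bsub>G\<^esub>}}" for u
  proof -
    obtain x where x: "x \<in> carrier G" "u = orbit G ?f x" using u by (auto simp: orbits_def)
    have "card u dvd p ^ n"
      unfolding x(2) n[symmetric] by (rule dvdI[OF A.orbit_stabilizer_theorem[OF x(1), symmetric]])
    then obtain k where k: "card u = p ^ k" using p by (auto simp: divides_primepow_nat)
    \<comment> \<open>A one-element orbit would make \<open>x\<close> central, hence the identity,
      but that orbit has been removed.\<close>
    have "card u \<noteq> 1"
    proof
      assume "card u = 1"
      moreover have xu: "x \<in> u" using x A.orbit_refl by simp
      ultimately have ux: "u = {x}" by (metis card_1_singletonE singletonD)
      have "x \<in> center G"
      proof (rule centerI[OF x(1)])
        fix g assume g: "g \<in> carrier G"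
        then have "g \<otimes>\<^bsub>G\<^esub> x \<otimes>\<^bsub>G\<^esub> inv\<^bsub>G\<^esub> g \<in> u" using x by (auto simp: orbit_def)
        then have "g \<otimes>\<^bsub>G\<^esub> x \<otimes>\<^bsub>G\<^esub> inv\<^bsub>G\<^esub> g = x" using ux by simp
        then show "x \<otimes>\<^bsub>G\<^esub> g = g \<otimes>\<^bsub>G\<^esub> x" using g x(1)
          by (metis inv_solve_right' m_closed)
      qed
      then show False using triv ux u by blast
    qed
    with k show ?thesis by (cases k) auto
  qed
  then have "p dvd (\<Sum>u\<in>?O - {{\<one>\<^bsub>G\<^esub>}}. card u)" by (intro dvd_sum)
  moreover have "order G = 1 + (\<Sum>u\<in>?O - {{\<one>\<^bsub>G\<^esub>}}. card u)"
  proof -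
    have "finite ?O" using fin by (simp add: orbits_def)
    \<comment> \<open>Summing the constant 1 over the disjoint orbits counts the carrier.\<close>
    moreover have "order G = (\<Sum>u\<in>?O. card u)"
      using A.disjoint_sum[OF fin, of "\<lambda>_. 1::nat"] by (simp add: order_def)
    ultimately show ?thesis using O1 by (simp add: sum.remove)
  qed
  moreover have "p dvd order G" using n nt by (cases n) auto
  ultimately have "p dvd 1" by (simp only: dvd_add_left_iff)
  then show False using p by (simp add: prime_nat_iff)
qed

section \<open>Surjective images, cosets and commutators in quotients\<close>

lemma (in group_hom) pth_power_subgroup_image:
  assumes "h ` carrier G = carrier H"
  shows "pth_power_subgroup p H = h ` pth_power_subgroup p G"
proof -
  have "{g [^]\<^bsub>H\<^esub> p | g. g \<in> carrier H} = h ` {g [^]\<^bsub>G\<^esub> p | g. g \<in> carrier G}"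
    unfolding assms[symmetric] by (force simp: hom_nat_pow)
  moreover have "{g [^]\<^bsub>G\<^esub> p | g. g \<in> carrier G} \<subseteq> carrier G" by auto
  ultimately show ?thesis
    unfolding pth_power_subgroup_def by (simp only: generate_img)
qed

lemma (in group_hom) center_image:
  assumes "h ` carrier G = carrier H"
  shows "h ` center G \<subseteq> center H"
proof
  fix y assume "y \<in> h ` center G"
  then obtain z where z: "z \<in> center G" "y = h z" by auto
  then have zc: "z \<in> carrier G" using center_subset[of G] by auto
  show "y \<in> center H"
  proof (rule centerI)
    fix w assume "w \<in> carrier H"
    then obtain g where g: "g \<in> carrier G" "w = h g" using assms by auto
    show "y \<otimes>\<^bsub>H\<^esub> w = w \<otimes>\<^bsub>H\<^esub> y"
      using center_commute[OF z(1) g(1)] zc g z by (metis hom_mult)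
  qed (use z zc in simp)
qed

context normal
begin

lemma group_hom_Mod: "group_hom G (G Mod H) ((#>) H)"
  using r_coset_hom_Mod factorgroup_is_group
  by (simp add: group_hom_def group_hom_axioms_def is_group)

lemma Mod_image: "(#>) H ` carrier G = carrier (G Mod H)"
  by (simp add: carrier_FactGroup)

lemma rcos_eq_one_iff: "a \<in> carrier G \<Longrightarrow> H #> a = \<one>\<^bsub>G Mod H\<^esub> \<longleftrightarrow> a \<in> H"
  using coset_join1[OF _ _ is_subgroup] coset_join2[OF _ is_subgroup] by auto

lemma rcos_eq_iff:
  assumes "a \<in> carrier G" "b \<in> carrier G"
  shows "H #> a = H #> b \<longleftrightarrow> (\<exists>k\<in>H. a = k \<otimes> b)"
proof
  assume "H #> a = H #> b"
  then have "a \<in> H #> b" using rcos_self[OF assms(1) is_subgroup] by simp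
  then show "\<exists>k\<in>H. a = k \<otimes> b" by (auto simp: r_coset_def)
next
  assume "\<exists>k\<in>H. a = k \<otimes> b"
  then have "a \<in> H #> b" by (auto simp: r_coset_def)
  then show "H #> a = H #> b"
    using repr_independence assms is_subgroup by metis
qed

lemma commutator_in_iff:
  assumes "a \<in> carrier G" "b \<in> carrier G"
  shows "a \<otimes> b \<otimes> inv a \<otimes> inv b \<in> H \<longleftrightarrow>
    (H #> a) \<otimes>\<^bsub>G Mod H\<^esub> (H #> b) = (H #> b) \<otimes>\<^bsub>G Mod H\<^esub> (H #> a)"
proof -
  interpret f: group_hom G "G Mod H" "(#>) H" by (rule group_hom_Mod)
  \<comment> \<open>Written as a quotient of \<open>a \<otimes> b\<close> by
    \<open>b \<otimes> a\<close>, the commutator is trivial modulo \<open>H\<close> exactly if these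
    two products have the same coset.\<close>
  have "a \<otimes> b \<otimes> inv a \<otimes> inv b = (a \<otimes> b) \<otimes> inv (b \<otimes> a)"
    using assms by (simp add: m_assoc inv_mult_group)
  then have "a \<otimes> b \<otimes> inv a \<otimes> inv b \<in> H \<longleftrightarrow> H #> ((a \<otimes> b) \<otimes> inv (b \<otimes> a)) = \<one>\<^bsub>G Mod H\<^esub>"
    using assms by (simp only: rcos_eq_one_iff m_closed inv_closed)
  also have "\<dots> \<longleftrightarrow> (H #> (a \<otimes> b)) \<otimes>\<^bsub>G Mod H\<^esub> inv\<^bsub>G Mod H\<^esub> (H #> (b \<otimes> a)) = \<one>\<^bsub>G Mod H\<^esub>"
    using assms by (simp only: f.hom_mult f.hom_inv m_closed inv_closed)
  also have "\<dots> \<longleftrightarrow> H #> (a \<otimes> b) = H #> (b \<otimes> a)"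
    using assms by (metis f.H.inv_equality f.H.r_inv f.H.inv_inv f.hom_closed f.H.inv_closed m_closed)
  finally show ?thesis
    using assms by (simp only: f.hom_mult)
qed

text \<open>Modulo \<open>H\<close> the generated group has one generator besides central ones, so
  its image is abelian. The main induction uses this twice: to bound the derived subgroup of a
  subgroup, and to show that a group generated by one element and its derived subgroup is
  abelian.\<close>

lemma derived_generate_insert_subset:
  assumes x: "x \<in> carrier G" and N: "N \<subseteq> carrier G"
    and cent: "(#>) H ` N \<subseteq> center (G Mod H)"
  shows "derived G (generate G (insert x N)) \<subseteq> H"
proof -
  interpret f: group_hom G "G Mod H" "(#>) H" by (rule group_hom_Mod)
  \<comment> \<open>\<open>?C a\<close> is the preimage in \<open>G\<close> of the centralizer of
    the coset \<open>a\<close>.\<close>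
  let ?X = "insert x N" and ?C = "\<lambda>a. {g \<in> carrier G. a \<otimes>\<^bsub>G Mod H\<^esub> (H #> g) = (H #> g) \<otimes>\<^bsub>G Mod H\<^esub> a}"
  have X: "?X \<subseteq> carrier G" using x N by simp
  have sub: "subgroup (?C a) G" if a: "a \<in> carrier (G Mod H)" for a
  proof -
    have "subgroup ({g \<in> carrier G. H #> g \<in> {b \<in> carrier (G Mod H). a \<otimes>\<^bsub>G Mod H\<^esub> b = b \<otimes>\<^bsub>G Mod H\<^esub> a}}) G"
      using factgroup_subgroup_union_subgroup[OF f.H.subgroup_commuting[OF a]]
      by (simp only: factgroup_subgroup_union_char[OF f.H.subgroup_commuting[OF a]])
    also have "{g \<in> carrier G. H #> g \<in> {b \<in> carrier (G Mod H). a \<otimes>\<^bsub>G Mod H\<^esub> b = b \<otimes>\<^bsub>G Mod H\<^esub> a}} = ?C a"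
      using f.hom_closed by auto
    finally show ?thesis .
  qed
  have comm: "(H #> a) \<otimes>\<^bsub>G Mod H\<^esub> (H #> b) = (H #> b) \<otimes>\<^bsub>G Mod H\<^esub> (H #> a)"
    if "a \<in> ?X" "b \<in> ?X" for a b
  proof -
    have c: "(H #> n) \<otimes>\<^bsub>G Mod H\<^esub> (H #> g) = (H #> g) \<otimes>\<^bsub>G Mod H\<^esub> (H #> n)" if "n \<in> N" "g \<in> carrier G" for n g
      using that cent by (intro center_commute) auto
    show ?thesis using that c X by (metis insertE subsetD)
  qed
  \<comment> \<open>Commuting with the generators extends to commuting with all they generate. This
    handles one argument of the commutator at a time and is applied below first to one argument,
    then to the other.\<close>
  have step: "(H #> a) \<otimes>\<^bsub>G Mod H\<^esub> (H #> g) = (H #> g) \<otimes>\<^bsub>G Mod H\<^esub> (H #> a)"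
    if a: "a \<in> carrier G" and *: "\<And>b. b \<in> ?X \<Longrightarrow> (H #> a) \<otimes>\<^bsub>G Mod H\<^esub> (H #> b) = (H #> b) \<otimes>\<^bsub>G Mod H\<^esub> (H #> a)"
      and g: "g \<in> generate G ?X" for a g
  proof -
    have "generate G ?X \<subseteq> ?C (H #> a)"
      using X * by (intro generate_subgroup_incl sub f.hom_closed a) auto
    then show ?thesis using g by blast
  qed
  have all: "a \<otimes> b \<otimes> inv a \<otimes> inv b \<in> H" if a: "a \<in> generate G ?X" and b: "b \<in> generate G ?X" for a b
  proof -
    have ac: "a \<in> carrier G" and bc: "b \<in> carrier G"
      using a b generate_in_carrier[OF X] by auto
    have "(H #> a) \<otimes>\<^bsub>G Mod H\<^esub> (H #> c) = (H #> c) \<otimes>\<^bsub>G Mod H\<^esub> (H #> a)" if "c \<in> ?X" for c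
      using step[of c a] comm that X a by (metis subsetD)
    then have "(H #> a) \<otimes>\<^bsub>G Mod H\<^esub> (H #> b) = (H #> b) \<otimes>\<^bsub>G Mod H\<^esub> (H #> a)"
      using step[OF ac] b by blast
    then show ?thesis by (simp only: commutator_in_iff[OF ac bc])
  qed
  show ?thesis
    unfolding derived_def using all by (intro generate_subgroup_incl is_subgroup) auto
qed

end

section \<open>Quotients and subgroups of p-groups, and nilpotency\<close>

lemma p_group_Mod:
  assumes p: "Factorial_Ring.prime p" and G: "p_group p G" and S: "S \<lhd> G"
  shows "p_group p (G Mod S)"
proof -
  interpret normal S G by (rule S)
  obtain n where n: "order G = p ^ n" using G by (auto simp: p_group_def)
  have "order (G Mod S) dvd p ^ n"
    using lagrange[OF is_subgroup] n by (metis FactGroup_def dvd_triv_left order_def partial_object.select_convs(1))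
  then show ?thesis
    using G p factorgroup_is_group
    by (auto simp: p_group_def divides_primepow_nat carrier_FactGroup)
qed

lemma p_group_subgroup:
  assumes p: "Factorial_Ring.prime p" and G: "p_group p G" and H: "subgroup H G"
  shows "p_group p (G\<lparr>carrier := H\<rparr>)"
proof -
  interpret group G using G by (simp add: p_group_def)
  obtain n where n: "order G = p ^ n" using G by (auto simp: p_group_def)
  have "card H dvd p ^ n"
    using lagrange[OF H] n by (metis dvd_triv_right)
  then show ?thesis
    using G p subgroup_imp_group[OF H] subgroup.subset[OF H]
    by (auto simp: p_group_def divides_primepow_nat order_def intro: finite_subset)
qed

text \<open>The form in which nilpotency of finite \<open>p\<close>-groups enters: \<open>S\<close> is chosen maximal among the normal
  subgroups over \<open>K\<close> not containing \<open>A\<close>, so the preimage of the center of \<open>G/S\<close> contains \<open>A\<close>.\<close>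

lemma p_group_central_quotient:
  fixes G (structure)
  assumes p: "Factorial_Ring.prime p" and G: "p_group p G"
    and K: "K \<lhd> G" and A: "A \<subseteq> carrier G" and nsub: "\<not> A \<subseteq> K"
  obtains S where "S \<lhd> G" "K \<subseteq> S" "\<not> A \<subseteq> S" "(#>) S ` A \<subseteq> center (G Mod S)"
proof -
  have fin: "finite (carrier G)" and "group G" using G by (auto simp: p_group_def)
  interpret group G by fact
  let ?F = "{S. S \<lhd> G \<and> K \<subseteq> S \<and> \<not> A \<subseteq> S}"
  have "?F \<subseteq> Pow (carrier G)"
    by (auto dest!: normal_imp_subgroup subgroup.subset)
  then have "finite ?F" using fin by (simp add: finite_subset)
  moreover have "K \<in> ?F" using K nsub by simp
  ultimately have "\<exists>S\<in>?F. K \<subseteq> S \<and> (\<forall>T\<in>?F. S \<subseteq> T \<longrightarrow> S = T)"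
    by (rule finite_has_maximal2)
  then obtain S where S: "S \<in> ?F" and max: "\<forall>T\<in>?F. S \<subseteq> T \<longrightarrow> S = T"
    by (elim bexE conjE)
  then have Sn: "S \<lhd> G" and KS: "K \<subseteq> S" and AS: "\<not> A \<subseteq> S" by auto
  interpret S: normal S G by (rule Sn)
  interpret f: group_hom G "G Mod S" "(#>) S" by (rule S.group_hom_Mod)
  \<comment> \<open>\<open>?T\<close> is the preimage of the center of
    \<open>G Mod S\<close>.\<close>
  let ?T = "{t \<in> carrier G. S #> t \<in> center (G Mod S)}"
  have Tn: "?T \<lhd> G"
    using S.factgroup_subgroup_union_normal[OF f.H.normal_center]
      S.factgroup_subgroup_union_char[OF f.H.subgroup_center] by simp
  have ST: "S \<subseteq> ?T"
  proof
    fix s assume s: "s \<in> S"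
    then have sc: "s \<in> carrier G" by (rule S.mem_carrier)
    then have "S #> s = \<one>\<^bsub>G Mod S\<^esub>" using s S.rcos_eq_one_iff by blast
    then show "s \<in> ?T" using sc subgroup.one_closed[OF f.H.subgroup_center] by simp
  qed
  have pQ: "p_group p (G Mod S)" by (rule p_group_Mod[OF p G Sn])
  have "order (G Mod S) \<noteq> 1"
  proof
    assume "order (G Mod S) = 1"
    then have triv: "carrier (G Mod S) = {\<one>\<^bsub>G Mod S\<^esub>}" using f.H.order_one_triv_iff by blast
    have "a \<in> S" if "a \<in> A" for a
      using S.rcos_eq_one_iff[of a] f.hom_closed[of a] triv that A by auto
    then show False using AS by auto
  qed
  from p_group_center_nontrivial[OF p pQ this]
  obtain z where z: "z \<in> center (G Mod S)" "z \<noteq> \<one>\<^bsub>G Mod S\<^esub>" by auto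
  then have "z \<in> (#>) S ` carrier G" using S.Mod_image center_subset[of "G Mod S"] by auto
  then obtain t where t: "t \<in> carrier G" "z = S #> t" by auto
  then have "t \<in> ?T" "t \<notin> S" using z S.rcos_eq_one_iff by auto
  \<comment> \<open>The lift \<open>t\<close> of a nontrivial central coset makes \<open>?T\<close>
    strictly larger than \<open>S\<close>, so maximality excludes \<open>?T\<close> from
    \<open>?F\<close>. As \<open>?T\<close> is normal and contains \<open>K\<close>, it can fail
    only by containing \<open>A\<close>.\<close>
  then have "S \<noteq> ?T" by auto
  then have "?T \<notin> ?F" using max ST by blast
  then have "A \<subseteq> ?T" using Tn ST KS by blast
  then show thesis using that[OF Sn KS AS] by auto
qed

section \<open>Powers in class at most 3 and at most 2\<close>

context group
begin

lemma commutator_in_derived: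
  "\<lbrakk>a \<in> carrier G; b \<in> carrier G\<rbrakk> \<Longrightarrow> a \<otimes> b \<otimes> inv a \<otimes> inv b \<in> derived G (carrier G)"
  unfolding derived_def by (rule generate.incl) auto

lemma nat_pow_conj:
  assumes [simp]: "g \<in> carrier G" "x \<in> carrier G"
  shows "g \<otimes> x [^] (n::nat) \<otimes> inv g = (g \<otimes> x \<otimes> inv g) [^] n"
proof (induction n)
  case (Suc n)
  have "inv g \<otimes> (g \<otimes> w) = w" if "w \<in> carrier G" for w
    using that by (simp flip: m_assoc)
  then show ?case
    by (simp only: nat_pow_Suc Suc[symmetric]) (simp add: m_assoc)
qed simp

text \<open>A conjugate of a power is the power of a conjugate, so the generating set is invariant.
  With \<open>N\<close> the derived subgroup this gives normality of \<open>K\<close>.\<close>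

lemma normal_generate_nat_pow:
  assumes "N \<lhd> G"
  shows "generate G {c [^] (p::nat) | c. c \<in> N} \<lhd> G"
proof -
  interpret N: normal N G by (rule assms)
  show ?thesis
  proof (rule normal_generateI)
    fix h g assume "h \<in> {c [^] p | c. c \<in> N}" and g: "g \<in> carrier G"
    then obtain c where c: "c \<in> N" "h = c [^] p" by auto
    then show "g \<otimes> h \<otimes> inv g \<in> {c [^] p | c. c \<in> N}"
      using g N.inv_op_closed2[OF g c(1)] nat_pow_conj[OF g N.mem_carrier[OF c(1)]] by auto
  qed auto
qed

text \<open>It suffices that p-th powers are central, for then
  \<open>pth_power_subgroup p G <#> center G\<close> lies in the center. Conjugating
  \<open>x\<close> by \<open>y\<close> multiplies it by a commutator \<open>c\<close>, and the power
  formula gives \<open>(x \<otimes> c) [^] p = x [^] p\<close>, since \<open>c\<close> and the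
  central commutator \<open>d\<close> both have trivial p-th power.\<close>

lemma derived_subset_center_if_class_3:
  assumes p: "odd p"
    and pow: "\<And>c. c \<in> derived G (carrier G) \<Longrightarrow> c [^] p = \<one>"
    and cen: "\<And>c x. \<lbrakk>c \<in> derived G (carrier G); x \<in> carrier G\<rbrakk> \<Longrightarrow> c \<otimes> x \<otimes> inv c \<otimes> inv x \<in> center G"
    and qp: "derived G (carrier G) \<subseteq> pth_power_subgroup p G <#> center G"
  shows "derived G (carrier G) \<subseteq> center G"
proof -
  have Dsub: "subgroup (derived G (carrier G)) G"
    using derived_is_subgroup[of "carrier G"] by simp
  have "x [^] p \<in> center G" if x: "x \<in> carrier G" for x
  proof (rule centerI)
    fix y assume y: "y \<in> carrier G"
    \<comment> \<open>Chosen so that \<open>x \<otimes> c\<close> is the conjugate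
      \<open>inv y \<otimes> x \<otimes> y\<close>; likewise \<open>d\<close> is chosen so that
      \<open>c \<otimes> x = x \<otimes> c \<otimes> d\<close>.\<close>
    define c where "c = inv x \<otimes> inv y \<otimes> x \<otimes> y"
    define d where "d = inv c \<otimes> inv x \<otimes> c \<otimes> x"
    have c: "c \<in> derived G (carrier G)"
      using commutator_in_derived[of "inv x" "inv y"] x y by (simp add: c_def)
    then have cc: "c \<in> carrier G" by (rule subgroup.mem_carrier[OF Dsub])
    then have dc: "d \<in> carrier G" using x by (simp add: d_def)
    have "d \<in> derived G (carrier G)"
      using commutator_in_derived[of "inv c" "inv x"] x cc by (simp add: d_def)
    then have dp: "d [^] p = \<one>" by (rule pow)
    have dcen: "d \<in> center G"
      using cen[OF subgroup.m_inv_closed[OF Dsub c], of "inv x"] x cc by (simp add: d_def)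
    have xy: "y \<otimes> (x \<otimes> c) = x \<otimes> y"
      using x y by (simp add: c_def m_assoc inv_solve_left' flip: m_assoc)
    have "c \<otimes> x = x \<otimes> c \<otimes> d"
      using x cc by (simp add: d_def flip: m_assoc) (simp add: m_assoc)
    then have "(x \<otimes> c) [^] p = x [^] p \<otimes> c [^] p \<otimes> d [^] (p choose 2)"
      using x cc dc by (intro nat_pow_mult_commutator_central) (auto intro: center_commute[OF dcen])
    also have "d [^] (p choose 2) = \<one>"
      using dvd_choose_2[OF p] dp dc by (auto simp flip: nat_pow_pow elim!: dvdE)
    finally have xc: "(x \<otimes> c) [^] p = x [^] p" using pow[OF c] x by simp
    \<comment> \<open>Conjugation by \<open>y\<close> carries \<open>(x \<otimes> c) [^] n\<close>
      to \<open>x [^] n\<close>; at \<open>n = p\<close> both powers coincide, so \<open>y\<close>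
      commutes with \<open>x [^] p\<close>.\<close>
    have "y \<otimes> (x \<otimes> c) [^] n = x [^] n \<otimes> y" for n :: nat
    proof (induction n)
      case (Suc n)
      have "y \<otimes> (x \<otimes> c) [^] Suc n = x [^] n \<otimes> (y \<otimes> (x \<otimes> c))"
        using x y cc Suc by (simp flip: m_assoc)
      also have "\<dots> = x [^] Suc n \<otimes> y"
        unfolding xy using x y by (simp add: m_assoc)
      finally show ?case .
    qed (use y in simp)
    from this[of p] show "x [^] p \<otimes> y = y \<otimes> x [^] p" by (simp add: xc)
  qed (use x in simp)
  then have "pth_power_subgroup p G \<subseteq> center G"
    unfolding pth_power_subgroup_def by (intro generate_subgroup_incl subgroup_center) auto
  then show ?thesis
    using qp subgroup.m_closed[OF subgroup_center] by (fastforce simp: set_mult_def)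
qed

text \<open>With central commutators of order dividing \<open>p\<close>, the power formula makes the
  p-th power map an endomorphism, and its image is a subgroup.\<close>

lemma pth_power_subgroup_eq_if_class_2:
  assumes p: "odd p"
    and pow: "\<And>c. c \<in> derived G (carrier G) \<Longrightarrow> c [^] p = \<one>"
    and cen: "derived G (carrier G) \<subseteq> center G"
  shows "pth_power_subgroup p G = {g [^] p | g. g \<in> carrier G}"
proof -
  have mult: "(x \<otimes> y) [^] p = x [^] p \<otimes> y [^] p" if x: "x \<in> carrier G" and y: "y \<in> carrier G" for x y
  proof -
    define d where "d = inv y \<otimes> inv x \<otimes> y \<otimes> x"
    have d: "d \<in> derived G (carrier G)"
      using commutator_in_derived[of "inv y" "inv x"] x y by (simp add: d_def)
    have dcen: "d \<in> center G" and dc: "d \<in> carrier G" using d cen center_subset[of G] by auto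
    have "y \<otimes> x = x \<otimes> y \<otimes> d"
      using x y by (simp add: d_def flip: m_assoc) (simp add: m_assoc)
    then have "(x \<otimes> y) [^] p = x [^] p \<otimes> y [^] p \<otimes> d [^] (p choose 2)"
      using x y dc by (intro nat_pow_mult_commutator_central) (auto intro: center_commute[OF dcen])
    also have "d [^] (p choose 2) = \<one>"
      using dvd_choose_2[OF p] pow[OF d] dc by (auto simp flip: nat_pow_pow elim!: dvdE)
    finally show ?thesis using x y by simp
  qed
  have "subgroup {g [^] p | g. g \<in> carrier G} G"
  proof (rule subgroupI)
    fix a assume "a \<in> {g [^] p | g. g \<in> carrier G}"
    then show "inv a \<in> {g [^] p | g. g \<in> carrier G}"
      by (auto simp flip: nat_pow_inv)
  next
    fix a b assume "a \<in> {g [^] p | g. g \<in> carrier G}" "b \<in> {g [^] p | g. g \<in> carrier G}"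
    then show "a \<otimes> b \<in> {g [^] p | g. g \<in> carrier G}"
      by (auto simp flip: mult)
  qed auto
  then have "pth_power_subgroup p G \<subseteq> {g [^] p | g. g \<in> carrier G}"
    unfolding pth_power_subgroup_def by (intro generate_subgroup_incl) auto
  then show ?thesis
    unfolding pth_power_subgroup_def by (auto intro: generate.incl)
qed

end

section \<open>Reduction modulo the p-th powers of the derived subgroup\<close>

lemma (in normal) image_subset_center_Mod_iff:
  assumes A: "A \<subseteq> carrier G"
  shows "(#>) H ` A \<subseteq> center (G Mod H) \<longleftrightarrow>
    (\<forall>a\<in>A. \<forall>g\<in>carrier G. a \<otimes> g \<otimes> inv a \<otimes> inv g \<in> H)"
proof -
  interpret f: group_hom G "G Mod H" "(#>) H" by (rule group_hom_Mod)
  have "H #> a \<in> center (G Mod H) \<longleftrightarrow> (\<forall>g\<in>carrier G. a \<otimes> g \<otimes> inv a \<otimes> inv g \<in> H)"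
    if "a \<in> A" for a
  proof -
    have a: "a \<in> carrier G" using that A by auto
    have "H #> a \<in> center (G Mod H) \<longleftrightarrow>
        (\<forall>g\<in>carrier G. (H #> a) \<otimes>\<^bsub>G Mod H\<^esub> (H #> g) = (H #> g) \<otimes>\<^bsub>G Mod H\<^esub> (H #> a))"
      unfolding center_def Mod_image[symmetric] using a by auto
    also have "\<dots> \<longleftrightarrow> (\<forall>g\<in>carrier G. a \<otimes> g \<otimes> inv a \<otimes> inv g \<in> H)"
      using commutator_in_iff[OF a] by blast
    finally show ?thesis .
  qed
  then show ?thesis by blast
qed

text \<open>The set \<open>?A\<close> generates [G', G]. If it were not inside \<open>K\<close>,
  some normal \<open>S\<close> over \<open>K\<close> would miss part of \<open>?A\<close> while
  \<open>?A\<close> is central modulo \<open>S\<close>. Then \<open>G Mod S\<close> has class at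
  most 3, and the class 3 lemma puts \<open>?A\<close> inside \<open>S\<close> after all.\<close>

lemma derived_central_mod_derived_pow:
  fixes G (structure)
  assumes p: "Factorial_Ring.prime p" and odd: "odd p" and G: "p_group p G"
    and qp: "derived G (carrier G) \<subseteq> pth_power_subgroup p G <#> center G"
  defines "K \<equiv> generate G {c [^] p | c. c \<in> derived G (carrier G)}"
  shows "(#>) K ` derived G (carrier G) \<subseteq> center (G Mod K)"
proof -
  interpret group G using G by (simp add: p_group_def)
  let ?D = "derived G (carrier G)"
  let ?A = "{c \<otimes> x \<otimes> inv c \<otimes> inv x | c x. c \<in> ?D \<and> x \<in> carrier G}"
  have Dc: "?D \<subseteq> carrier G" by (simp add: derived_in_carrier)
  have K: "K \<lhd> G" unfolding K_def by (rule normal_generate_nat_pow[OF derived_self_is_normal])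
  have A: "?A \<subseteq> carrier G" using Dc by auto
  have "?A \<subseteq> K"
  proof (rule ccontr)
    assume "\<not> ?A \<subseteq> K"
    from p_group_central_quotient[OF p G K A this]
    obtain S where S: "S \<lhd> G" "K \<subseteq> S" "\<not> ?A \<subseteq> S" "(#>) S ` ?A \<subseteq> center (G Mod S)" .
    interpret S: normal S G by (rule S(1))
    interpret f: group_hom G "G Mod S" "(#>) S" by (rule S.group_hom_Mod)
    have DQ: "derived (G Mod S) (carrier (G Mod S)) = (#>) S ` ?D"
      using f.derived_img[of "carrier G"] S.Mod_image by simp
    have "derived (G Mod S) (carrier (G Mod S)) \<subseteq> center (G Mod S)"
    proof (rule f.H.derived_subset_center_if_class_3[OF odd])
      fix c' assume "c' \<in> derived (G Mod S) (carrier (G Mod S))"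
      then obtain c where c: "c \<in> ?D" "c' = S #> c" by (auto simp: DQ)
      then have cc: "c \<in> carrier G" using Dc by auto
      have "c [^] p \<in> S" using S(2) c by (auto simp: K_def intro!: generate.incl)
      then show "c' [^]\<^bsub>G Mod S\<^esub> p = \<one>\<^bsub>G Mod S\<^esub>"
        using cc c S.rcos_eq_one_iff[of "c [^] p"] f.hom_nat_pow[OF cc, of p] by simp
    next
      fix c' x' assume "c' \<in> derived (G Mod S) (carrier (G Mod S))" "x' \<in> carrier (G Mod S)"
      then obtain c x where c: "c \<in> ?D" "c' = S #> c" and x: "x \<in> carrier G" "x' = S #> x"
        unfolding DQ unfolding S.Mod_image[symmetric] by blast
      then have cc: "c \<in> carrier G" using Dc by auto
      have "S #> (c \<otimes> x \<otimes> inv c \<otimes> inv x) \<in> center (G Mod S)"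
        using S(4) c x by blast
      moreover have "S #> (c \<otimes> x \<otimes> inv c \<otimes> inv x) =
          c' \<otimes>\<^bsub>G Mod S\<^esub> x' \<otimes>\<^bsub>G Mod S\<^esub> inv\<^bsub>G Mod S\<^esub> c' \<otimes>\<^bsub>G Mod S\<^esub> inv\<^bsub>G Mod S\<^esub> x'"
        unfolding c x using cc x(1) by (simp only: f.hom_mult f.hom_inv m_closed inv_closed)
      ultimately show "c' \<otimes>\<^bsub>G Mod S\<^esub> x' \<otimes>\<^bsub>G Mod S\<^esub> inv\<^bsub>G Mod S\<^esub> c' \<otimes>\<^bsub>G Mod S\<^esub> inv\<^bsub>G Mod S\<^esub> x'
          \<in> center (G Mod S)" by simp
    next
      \<comment> \<open>The hypothesis \<open>qp\<close> survives in quotients: p-th power subgroups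
        map onto p-th power subgroups, and the center maps into the center.\<close>
      show "derived (G Mod S) (carrier (G Mod S))
          \<subseteq> pth_power_subgroup p (G Mod S) <#>\<^bsub>G Mod S\<^esub> center (G Mod S)"
      proof
        fix c' assume "c' \<in> derived (G Mod S) (carrier (G Mod S))"
        then obtain c where c: "c \<in> ?D" "c' = S #> c" by (auto simp: DQ)
        then obtain u z where uz: "u \<in> pth_power_subgroup p G" "z \<in> center G" "c = u \<otimes> z"
          using qp unfolding set_mult_def by blast
        have "u \<in> carrier G"
          using uz(1) generate_in_carrier[of "{g [^] p | g. g \<in> carrier G}"]
          unfolding pth_power_subgroup_def by blast
        moreover have "z \<in> carrier G" using uz(2) center_subset[of G] by auto
        ultimately have "c' = (S #> u) \<otimes>\<^bsub>G Mod S\<^esub> (S #> z)" using c uz by (simp only: f.hom_mult)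
        moreover have "S #> u \<in> pth_power_subgroup p (G Mod S)"
          using f.pth_power_subgroup_image[OF S.Mod_image] uz by simp
        moreover have "S #> z \<in> center (G Mod S)"
          using f.center_image[OF S.Mod_image] uz by blast
        ultimately show "c' \<in> pth_power_subgroup p (G Mod S) <#>\<^bsub>G Mod S\<^esub> center (G Mod S)"
          unfolding set_mult_def by blast
      qed
    qed
    then have "\<forall>c\<in>?D. \<forall>x\<in>carrier G. c \<otimes> x \<otimes> inv c \<otimes> inv x \<in> S"
      using S.image_subset_center_Mod_iff[OF Dc] DQ by simp
    then show False using S(3) by blast
  qed
  then show ?thesis using normal.image_subset_center_Mod_iff[OF K Dc] by blast
qed

text \<open>In \<open>G Mod K\<close> the derived subgroup is central of exponent dividing
  \<open>p\<close>, so there the coset of \<open>g\<close> is itself a p-th power. The factor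
  \<open>k\<close> is the error made in lifting that equation to \<open>G\<close>.\<close>

lemma pth_power_subgroup_decompose:
  fixes G (structure)
  assumes K: "K \<lhd> G" and odd: "odd p"
    and pow: "\<And>c. c \<in> derived G (carrier G) \<Longrightarrow> c [^] p \<in> K"
    and cen: "(#>) K ` derived G (carrier G) \<subseteq> center (G Mod K)"
    and g: "g \<in> pth_power_subgroup p G"
  obtains x k where "x \<in> carrier G" "k \<in> K" "g = k \<otimes> x [^] p"
proof -
  interpret K: normal K G by (rule K)
  interpret f: group_hom G "G Mod K" "(#>) K" by (rule K.group_hom_Mod)
  have DQ: "derived (G Mod K) (carrier (G Mod K)) = (#>) K ` derived G (carrier G)"
    using f.derived_img[of "carrier G"] K.Mod_image by simp
  have Dc: "derived G (carrier G) \<subseteq> carrier G" by (simp add: K.derived_in_carrier)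
  have gc: "g \<in> carrier G"
    using g K.generate_in_carrier[of "{g [^] p | g. g \<in> carrier G}"]
    unfolding pth_power_subgroup_def by blast
  have "pth_power_subgroup p (G Mod K) = {y [^]\<^bsub>G Mod K\<^esub> p | y. y \<in> carrier (G Mod K)}"
  proof (rule f.H.pth_power_subgroup_eq_if_class_2[OF odd])
    fix c' assume "c' \<in> derived (G Mod K) (carrier (G Mod K))"
    then obtain c where c: "c \<in> derived G (carrier G)" "c' = K #> c" by (auto simp: DQ)
    then have cc: "c \<in> carrier G" using Dc by auto
    then show "c' [^]\<^bsub>G Mod K\<^esub> p = \<one>\<^bsub>G Mod K\<^esub>"
      using c K.rcos_eq_one_iff[of "c [^] p"] f.hom_nat_pow[OF cc, of p] pow[OF c(1)] by simp
  qed (use cen DQ in simp)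
  moreover have "K #> g \<in> pth_power_subgroup p (G Mod K)"
    using f.pth_power_subgroup_image[OF K.Mod_image] g by simp
  ultimately obtain y where "y \<in> carrier (G Mod K)" "K #> g = y [^]\<^bsub>G Mod K\<^esub> p" by auto
  then obtain x where x: "x \<in> carrier G" "K #> g = K #> (x [^] p)"
    by (auto simp: K.Mod_image[symmetric] f.hom_nat_pow)
  then obtain k where "k \<in> K" "g = k \<otimes> x [^] p"
    using K.rcos_eq_iff[OF gc K.nat_pow_closed[OF x(1)]] by blast
  with x(1) that show thesis by blast
qed

section \<open>Induction on the order, through subgroups generated by one element and G'\<close>

lemma pth_power_subgroup_eq_pth_powers:
  fixes G (structure)
  assumes p: "Factorial_Ring.prime p" and odd: "odd p" and G: "p_group p G"
    and qp: "derived G (carrier G) \<subseteq> pth_power_subgroup p G <#> center G"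
  shows "pth_power_subgroup p G = {g [^] p | g. g \<in> carrier G}"
  using G qp
proof (induction "order G" arbitrary: G rule: less_induct)
  case (less G)
  note G = less.prems(1) and qp = less.prems(2)
  interpret group G using G by (simp add: p_group_def)
  have fin: "finite (carrier G)" using G by (simp add: p_group_def)
  define D where "D = derived G (carrier G)"
  define K where "K = generate G {c [^]\<^bsub>G\<^esub> p | c. c \<in> D}"
  have Dc: "D \<subseteq> carrier G" by (simp add: D_def derived_in_carrier)
  have K: "K \<lhd> G" unfolding K_def D_def by (rule normal_generate_nat_pow[OF derived_self_is_normal])
  have cen: "(#>\<^bsub>G\<^esub>) K ` D \<subseteq> center (G Mod K)"
    unfolding K_def D_def by (rule derived_central_mod_derived_pow[OF p odd G qp])
  have "g \<in> {g [^]\<^bsub>G\<^esub> p | g. g \<in> carrier G}" if g: "g \<in> pth_power_subgroup p G" for g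
  proof -
    have powK: "c [^]\<^bsub>G\<^esub> p \<in> K" if "c \<in> derived G (carrier G)" for c
      using that by (auto simp: K_def D_def intro!: generate.incl)
    obtain x k where x: "x \<in> carrier G" and k: "k \<in> K" and gkx: "g = k \<otimes>\<^bsub>G\<^esub> x [^]\<^bsub>G\<^esub> p"
      using pth_power_subgroup_decompose[OF K odd powK cen[unfolded D_def] g] by blast
    define H where "H = generate G (insert x D)"
    have XG: "insert x D \<subseteq> carrier G" using x Dc by simp
    have H: "subgroup H G" unfolding H_def by (rule generate_is_subgroup[OF XG])
    have xH: "x \<in> H" and DH: "D \<subseteq> H" by (auto simp: H_def intro: generate.incl)
    let ?H = "G\<lparr>carrier := H\<rparr>"
    \<comment> \<open>Powers and generated subgroups of \<open>?H\<close> may be computed in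
      \<open>G\<close>, which makes \<open>K\<close> and \<open>g\<close> comparable with
      \<open>pth_power_subgroup p ?H\<close>.\<close>
    have PH: "pth_power_subgroup p ?H = generate G {h [^]\<^bsub>G\<^esub> p | h. h \<in> H}"
    proof -
      interpret H: group ?H by (rule subgroup_imp_group[OF H])
      have "{h [^]\<^bsub>?H\<^esub> p | h. h \<in> H} = {h [^]\<^bsub>G\<^esub> p | h. h \<in> H}"
        by (simp flip: nat_pow_consistent)
      moreover have "{h [^]\<^bsub>G\<^esub> p | h. h \<in> H} \<subseteq> H"
        using H.nat_pow_closed[of _ p] by (auto simp flip: nat_pow_consistent)
      ultimately show ?thesis
        unfolding pth_power_subgroup_def using generate_consistent[OF _ H] by simp
    qed
    have KP: "K \<subseteq> pth_power_subgroup p ?H"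
      unfolding PH K_def using DH by (intro mono_generate) auto
    show ?thesis
    proof (cases "H = carrier G")
      case False
      then have "order ?H < order G"
        using subgroup.subset[OF H] fin by (auto simp: order_def intro!: psubset_card_mono)
      moreover have "p_group p ?H" by (rule p_group_subgroup[OF p G H])
      \<comment> \<open>\<open>?H\<close> is even powerful: its derived subgroup lies in
        \<open>K\<close>, hence among the products of p-th powers from \<open>?H\<close>, and the
        central factor can be taken to be the identity.\<close>
      moreover have "derived ?H (carrier ?H) \<subseteq> pth_power_subgroup p ?H <#>\<^bsub>?H\<^esub> center ?H"
      proof
        fix c assume "c \<in> derived ?H (carrier ?H)"
        then have "c \<in> derived G H" using derived_consistent[OF subset_refl H] by simp
        then have cK: "c \<in> K"
          using normal.derived_generate_insert_subset[OF K x Dc cen] by (auto simp: H_def)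
        then have "c \<in> pth_power_subgroup p ?H" using KP by auto
        moreover have "\<one>\<^bsub>G\<^esub> \<in> center ?H"
          using subgroup.one_closed[OF H] subgroup.mem_carrier[OF H] by (auto intro!: centerI)
        moreover have "c = c \<otimes>\<^bsub>?H\<^esub> \<one>\<^bsub>G\<^esub>"
          using subgroup.mem_carrier[OF normal_imp_subgroup[OF K] cK] by simp
        ultimately show "c \<in> pth_power_subgroup p ?H <#>\<^bsub>?H\<^esub> center ?H"
          unfolding set_mult_def by blast
      qed
      ultimately have IH: "pth_power_subgroup p ?H = {h [^]\<^bsub>?H\<^esub> p | h. h \<in> carrier ?H}"
        by (rule less.hyps)
      \<comment> \<open>Both factors of \<open>g = k \<otimes> x [^] p\<close> lie there, so the
        induction hypothesis absorbs \<open>k\<close> and yields a single p-th power.\<close>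
      have "g \<in> pth_power_subgroup p ?H"
        unfolding gkx PH
      proof (rule generate.eng)
        show "k \<in> generate G {h [^]\<^bsub>G\<^esub> p | h. h \<in> H}" using k KP PH by auto
        show "x [^]\<^bsub>G\<^esub> p \<in> generate G {h [^]\<^bsub>G\<^esub> p | h. h \<in> H}"
          using xH by (intro generate.incl) auto
      qed
      then show ?thesis
        unfolding IH using subgroup.mem_carrier[OF H] by (auto simp flip: nat_pow_consistent)
    next
      case True
      \<comment> \<open>Otherwise some normal \<open>S\<close> does not contain \<open>D\<close>
        although \<open>D\<close> is central modulo \<open>S\<close>. Then \<open>G Mod S\<close>,
        generated by the coset of \<open>x\<close> and central cosets, is abelian, which forces
        \<open>D\<close> into \<open>S\<close>.\<close>
      have "D \<subseteq> {\<one>\<^bsub>G\<^esub>}"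
      proof (rule ccontr)
        assume "\<not> D \<subseteq> {\<one>\<^bsub>G\<^esub>}"
        from p_group_central_quotient[OF p G one_is_normal Dc this]
        obtain S where S: "S \<lhd> G" "\<not> D \<subseteq> S" "(#>\<^bsub>G\<^esub>) S ` D \<subseteq> center (G Mod S)" .
        then show False
          using normal.derived_generate_insert_subset[OF S(1) x Dc S(3)] True
          by (simp add: H_def D_def)
      qed
      then have "{c [^]\<^bsub>G\<^esub> p | c. c \<in> D} \<subseteq> {\<one>\<^bsub>G\<^esub>}" by auto
      then have "K \<subseteq> {\<one>\<^bsub>G\<^esub>}"
        unfolding K_def by (rule generate_subgroup_incl[OF _ triv_subgroup])
      then have "k = \<one>\<^bsub>G\<^esub>" using k by auto
      then show ?thesis using gkx x by auto
    qed
  qed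
  then show ?case
    unfolding pth_power_subgroup_def by (auto intro: generate.incl)
qed

theorem theorem4p6:
  fixes G :: "('a, 'b) monoid_scheme" and p :: nat
  assumes "Factorial_Ring.prime p" and "odd p"
    and "p_group p G"
    and "quasi_powerful p G"
  shows "pth_power_subgroup p G = {g [^]\<^bsub>G\<^esub> p | g. g \<in> carrier G}"
proof (rule pth_power_subgroup_eq_pth_powers[OF assms(1-3)])
  interpret group G using assms(3) by (simp add: p_group_def)
  interpret Z: normal "center G" G by (rule normal_center)
  let ?f = "(#>\<^bsub>G\<^esub>) (center G)"
  interpret f: group_hom G "G Mod center G" ?f by (rule Z.group_hom_Mod)
  \<comment> \<open>A derived element and some \<open>u\<close> in the p-th power subgroup share a
    coset of the center, so they differ by a central factor, which may be moved to the
    right.\<close>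
  show "derived G (carrier G) \<subseteq> pth_power_subgroup p G <#>\<^bsub>G\<^esub> center G"
  proof
    fix c assume c: "c \<in> derived G (carrier G)"
    then have "?f c \<in> derived (G Mod center G) (carrier (G Mod center G))"
      using f.derived_img[of "carrier G"] Z.Mod_image by auto
    then have "?f c \<in> pth_power_subgroup p (G Mod center G)"
      using assms(4) by (auto simp: quasi_powerful_def powerful_def)
    then obtain u where u: "u \<in> pth_power_subgroup p G" "?f c = ?f u"
      using f.pth_power_subgroup_image[OF Z.Mod_image] by auto
    have uc: "u \<in> carrier G"
      using u(1) generate_in_carrier[of "{g [^]\<^bsub>G\<^esub> p | g. g \<in> carrier G}"]
      unfolding pth_power_subgroup_def by blast
    have "c \<in> carrier G" using c derived_in_carrier[of "carrier G"] by auto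
    with uc u(2) obtain z where z: "z \<in> center G" "c = z \<otimes>\<^bsub>G\<^esub> u"
      using Z.rcos_eq_iff by blast
    then have "c = u \<otimes>\<^bsub>G\<^esub> z" using center_commute[OF z(1) uc] by simp
    then show "c \<in> pth_power_subgroup p G <#>\<^bsub>G\<^esub> center G"
      using u z unfolding set_mult_def by blast
  qed
qed

end
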